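(* Let $m,n$ be integers with $m\ge n\ge0$ and let $f_n(x)\in\mathbb{C}[x]$ be any polynomial of degree $n$. Then for all $k\in\mathbb{Z}\setminus\{-m,\ldots,-1,0\}$, \[f_n(x+k)=k\binom{m+k}{m}\sum_{j=0}^m(-1)^j\frac{1}{k+j}\binom mj f_n(x-j).\]
   Context: For integers $N$ and $m\ge0$, $\binom Nm=N(N-1)\cdots(N-m+1)/m!$. *)

theory Defs
  imports Complex_Main "HOL-Computational_Algebra.Polynomial"
begin

end

theory Submission
  imports Defs
begin

text \<open>As a polynomial in \<open>k\<close>, the right-hand side is the Lagrange interpolant of \<open>f (x + k)\<close> at the
  \<open>m + 1\<close> nodes \<open>k = 0, -1, \<dots>, -m\<close>: the prefactor equals \<open>k (k + 1) \<cdots> (k + m) / m!\<close>, and division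
  by \<open>k + j\<close> removes the factor that vanishes at \<open>-j\<close>. Since \<open>f\<close> has degree at most \<open>m\<close>, it
  agrees with its interpolant.\<close>

text \<open>These are the denominators of the Lagrange weights at the nodes
  \<open>0, -1, ..., -m\<close>. The \<open>l\<close> indices below \<open>l\<close> contribute
  negative factors with absolute values \<open>l, ..., 1\<close>; those above contribute
  \<open>1, ..., m - l\<close>.\<close>

lemma prod_shifted_index_diff:
  assumes "l \<le> m"
  shows "(\<Prod>i\<in>{0..m} - {l}. of_nat i - of_nat l :: 'a::{comm_ring_1, semiring_char_0}) =
    (-1) ^ l * fact l * fact (m - l)"
proof -
  have split: "{0..m} - {l} = {0..<l} \<union> {Suc l..m}"
    using assms by auto
  have "(\<Prod>i\<in>{0..<l}. of_nat i - of_nat l :: 'a) = (\<Prod>i\<in>{0..<l}. - of_nat (l - i))"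
    by (intro prod.cong) (auto simp: of_nat_diff)
  also have "\<dots> = (-1) ^ l * (\<Prod>i\<in>{0..<l}. of_nat (l - i))"
    by (subst prod_uminus) simp
  also have "(\<Prod>i\<in>{0..<l}. of_nat (l - i) :: 'a) = fact l"
    by (simp add: fact_prod_rev)
  finally have low: "(\<Prod>i\<in>{0..<l}. of_nat i - of_nat l :: 'a) = (-1) ^ l * fact l" .
  have "(\<Prod>i\<in>{Suc l..m}. of_nat i - of_nat l :: 'a) = (\<Prod>i\<in>{1..m - l}. of_nat i)"
    by (rule prod.reindex_bij_witness[of _ "\<lambda>i. i + l" "\<lambda>i. i - l"])
       (use assms in \<open>auto simp: of_nat_diff\<close>)
  also have "\<dots> = fact (m - l)"
    by (simp add: fact_prod)
  finally have high: "(\<Prod>i\<in>{Suc l..m}. of_nat i - of_nat l :: 'a) = fact (m - l)" .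
  show ?thesis
    unfolding split by (subst prod.union_disjoint) (auto simp: low high)
qed

text \<open>The weight at node \<open>- j\<close> is the reciprocal of
  \<open>(-1) ^ j * fact j * fact (m - j)\<close>, which equals
  \<open>(-1) ^ j * (m choose j) / fact m\<close>. Both sides have degree at most \<open>m\<close>
  in \<open>t\<close> and agree at \<open>m + 1\<close> distinct points.\<close>

lemma lagrange_interpolation_neg_nat:
  fixes p :: "'a::field_char_0 poly"
  assumes "degree p \<le> m"
  shows "poly p t = (\<Sum>j=0..m. (-1) ^ j * of_nat (m choose j) / fact m * poly p (- of_nat j) *
    (\<Prod>i\<in>{0..m} - {j}. t + of_nat i))"
proof -
  define c where "c j = (-1) ^ j * of_nat (m choose j) / fact m * poly p (- of_nat j)" for j
  define L where "L = (\<Sum>j=0..m. smult (c j) (\<Prod>i\<in>{0..m} - {j}. [:of_nat i, 1:]))"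
  have poly_L: "poly L s = (\<Sum>j=0..m. c j * (\<Prod>i\<in>{0..m} - {j}. s + of_nat i))" for s
    by (simp add: L_def poly_sum poly_prod add.commute)
  have deg_L: "degree L \<le> m"
    unfolding L_def
  proof (intro degree_sum_le)
    fix j assume "j \<in> {0..m}"
    have "degree (\<Prod>i\<in>{0..m} - {j}. [:of_nat i, 1 :: 'a:]) \<le>
        (\<Sum>i\<in>{0..m} - {j}. degree [:of_nat i, 1 :: 'a:])"
      by (rule degree_prod_sum_le[unfolded o_def]) simp
    also have "\<dots> \<le> m"
      using \<open>j \<in> {0..m}\<close> by simp
    finally show "degree (smult (c j) (\<Prod>i\<in>{0..m} - {j}. [:of_nat i, 1:])) \<le> m"
      using degree_smult_le order_trans by blast
  qed simp
  have "p = L"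
  proof (rule poly_eqI_degree[of "(\<lambda>l. - of_nat l) ` {0..m}"])
    fix y :: 'a assume "y \<in> (\<lambda>l. - of_nat l) ` {0..m}"
    then obtain l where l: "l \<le> m" and y: "y = - of_nat l"
      by auto
    \<comment> \<open>At the node \<open>- l\<close>, every summand with \<open>j \<noteq> l\<close>
      contains the vanishing factor with index \<open>i = l\<close>.\<close>
    have "poly L y = (\<Sum>j=0..m. if j = l then c l * (\<Prod>i\<in>{0..m} - {l}. y + of_nat i) else 0)"
      unfolding poly_L
    proof (rule sum.cong)
      fix j assume "j \<in> {0..m}"
      show "c j * (\<Prod>i\<in>{0..m} - {j}. y + of_nat i) =
          (if j = l then c l * (\<Prod>i\<in>{0..m} - {l}. y + of_nat i) else 0)"
      proof (cases "j = l")
        case False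
        then have "(\<Prod>i\<in>{0..m} - {j}. y + of_nat i) = 0"
          using l by (intro prod_zero) (auto simp: y intro!: bexI[of _ l])
        with False show ?thesis by simp
      qed simp
    qed simp
    also have "\<dots> = c l * (\<Prod>i\<in>{0..m} - {l}. of_nat i - of_nat l)"
      using l by (simp add: y)
    also have "\<dots> = ((-1) ^ l * (-1) ^ l) *
        (fact l * fact (m - l) * of_nat (m choose l)) / fact m * poly p y"
      by (simp add: prod_shifted_index_diff[OF l] c_def y)
    also have "fact l * fact (m - l) * of_nat (m choose l) = (fact m :: 'a)"
      using l by (simp add: binomial_fact)
    also have "(-1) ^ l * (-1) ^ l = (1 :: 'a)"
      by (simp flip: power_mult_distrib)
    finally show "poly p y = poly L y" by simp
  next
    have "card ((\<lambda>l. - of_nat l :: 'a) ` {0..m}) = Suc m"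
      by (subst card_image) (auto simp: inj_on_def)
    then show "card ((\<lambda>l. - of_nat l :: 'a) ` {0..m}) > degree p"
      and "card ((\<lambda>l. - of_nat l :: 'a) ` {0..m}) > degree L"
      using assms deg_L by auto
  qed
  then show ?thesis
    using poly_L[of t] by (simp add: c_def)
qed

text \<open>The binomial is the rising factorial \<open>(a + 1) ... (a + m)\<close> over
  \<open>fact m\<close>; the extra \<open>a\<close> supplies the missing factor at
  \<open>i = 0\<close>.\<close>

lemma mult_gbinomial_add_eq_prod:
  fixes a :: "'a::field_char_0"
  shows "a * ((of_nat m + a) gchoose m) = (\<Prod>i\<in>{0..m}. a + of_nat i) / fact m"
proof -
  have "a * ((of_nat m + a) gchoose m) = a * pochhammer (a + 1) m / fact m"
    by (simp add: gbinomial_pochhammer')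
  also have "a * pochhammer (a + 1) m = (\<Prod>i\<in>{0..m}. a + of_nat i)"
    using pochhammer_rec[of a m]
    by (simp only: pochhammer_prod[of a "Suc m"] atLeastLessThanSuc_atLeastAtMost)
  finally show ?thesis .
qed

theorem theorem8p9:
  fixes m n :: nat and f :: "complex poly" and k :: int and x :: complex
  assumes "n \<le> m"
    and "degree f = n"
    and "k \<notin> {- int m..0}"
  shows "poly f (x + of_int k) =
    of_int k * (of_int (int m + k) gchoose m) *
      (\<Sum>j=0..m. (-1) ^ j * (1 / (of_int k + of_nat j)) * of_nat (m choose j) *
         poly f (x - of_nat j))"
proof -
  define K where "K = (of_int k :: complex)"
  define P where "P = (\<Prod>i\<in>{0..m}. K + of_nat i)"
  \<comment> \<open>The excluded values of \<open>k\<close> are exactly those for which some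
    \<open>K + j\<close> with \<open>j \<le> m\<close> is zero, so the division is
    legitimate.\<close>
  have remove: "(\<Prod>i\<in>{0..m} - {j}. K + of_nat i) = P / (K + of_nat j)" if "j \<in> {0..m}" for j
  proof -
    have "k + int j \<noteq> 0"
      using that assms(3) by auto
    then have "K + of_nat j \<noteq> 0"
      unfolding K_def by (metis of_int_add of_int_eq_0_iff of_int_of_nat_eq)
    moreover have "P = (K + of_nat j) * (\<Prod>i\<in>{0..m} - {j}. K + of_nat i)"
      unfolding P_def using that by (intro prod.remove) auto
    ultimately show ?thesis by simp
  qed
  \<comment> \<open>With \<open>x\<close> fixed, the polynomial to interpolate is
    \<open>f (x + t)\<close> in \<open>t\<close>; its value at the node \<open>- j\<close> is
    \<open>f (x - j)\<close>.\<close>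
  have "degree (pcompose f [:x, 1:]) \<le> m"
    using assms by (simp add: degree_pcompose)
  from lagrange_interpolation_neg_nat[OF this, of K]
  have "poly f (x + K) = (\<Sum>j=0..m. (-1) ^ j * of_nat (m choose j) / fact m *
      poly f (x - of_nat j) * (\<Prod>i\<in>{0..m} - {j}. K + of_nat i))"
    by (simp add: poly_pcompose)
  also have "\<dots> = (\<Sum>j=0..m. P / fact m * ((-1) ^ j * (1 / (K + of_nat j)) *
      of_nat (m choose j) * poly f (x - of_nat j)))"
    by (intro sum.cong refl) (simp add: remove)
  also have "\<dots> = K * ((of_nat m + K) gchoose m) * (\<Sum>j=0..m. (-1) ^ j * (1 / (K + of_nat j)) *
      of_nat (m choose j) * poly f (x - of_nat j))"
    by (simp add: sum_distrib_left mult_gbinomial_add_eq_prod P_def)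
  finally show ?thesis
    by (simp add: K_def)
qed

end
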